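(* Let $X=\{x_1,x_2,\ldots\}$ be a finite or infinite set of indeterminates, let $t$ be a further indeterminate, and let $\frac{X}{1-tX}$ denote the alphabet $\left\{\frac{x_1}{1-tx_1},\frac{x_2}{1-tx_2},\ldots\right\}$. For every integer $k\ge 1$ one has, as formal power series in $t$, $$p_k\left(\frac{X}{1-tX}\right)=\sum_{|\mu|\ge k}t^{|\mu|-k}\binom{|\mu|}{k}(-1)^{|\mu|-l(\mu)}\frac{k\,(l(\mu)-1)!}{\prod_i m_i(\mu)!}\,e_\mu(X),$$ $$p_k\left(\frac{X}{1-tX}\right)=\sum_{|\mu|\ge k}t^{|\mu|-k}\binom{|\mu|}{k}(-1)^{l(\mu)-1}\frac{k\,(l(\mu)-1)!}{\prod_i m_i(\mu)!}\,h_\mu(X),$$ where both sums run over all integer partitions $\mu$ with $|\mu|\ge k$.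
   Context: For an integer partition $\mu=(\mu_1,\mu_2,\ldots)$: $|\mu|$ is the sum of its parts, $l(\mu)$ its number of (nonzero) parts, and $m_i(\mu)$ the number of parts equal to $i\ge1$. For an alphabet $A=\{a_1,a_2,\ldots\}$: $p_n(A)=\sum_{r\ge1}a_r^n$ (power sums, $n\geq 1$), and $e_n(A)$, $h_n(A)$ are the elementary and complete homogeneous symmetric functions, with generating functions $\sum_{n\ge0}e_n(A)s^n=\prod_{r\ge1}(1+a_rs)$ and $\sum_{n\ge0}h_n(A)s^n=\prod_{r\ge1}(1-a_rs)^{-1}$. Moreover $e_\mu(A)=\prod_r e_{\mu_r}(A)$ and $h_\mu(A)=\prod_r h_{\mu_r}(A)$, the products being over the parts of $\mu$. The fractions $\frac{x_r}{1-tx_r}$ are expanded as power series in $t$. *)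

theory Defs
  imports
    "HOL-Analysis.Infinite_Sum"
    "HOL-Computational_Algebra.Formal_Power_Series"
    "HOL-Library.Multiset"
begin

section \<open>Formal power series in arbitrarily many indeterminates\<close>

text \<open>
  Indeterminates are indexed by a type \<open>'i\<close>, and a monomial is the multiset of its
  indeterminates, so that multiplication of monomials is multiset union.
\<close>

typedef (overloaded) ('i, 'a) mps = "UNIV :: ('i multiset \<Rightarrow> 'a) set"
  morphisms mps_coeff Abs_mps ..

setup_lifting type_definition_mps

lemma mps_ext: "(\<And>m. mps_coeff f m = mps_coeff g m) \<Longrightarrow> f = g"
  by transfer auto

lemma finite_submultisets [simp]: "finite {a. a \<subseteq># (m :: 'i multiset)}"
proof (induction m)
  case empty
  show ?case by simp
next
  case (add x m)
  have "{a. a \<subseteq># add_mset x m} \<subseteq> {a. a \<subseteq># m} \<union> add_mset x ` {a. a \<subseteq># m}"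
  proof
    fix a assume a: "a \<in> {a. a \<subseteq># add_mset x m}"
    show "a \<in> {a. a \<subseteq># m} \<union> add_mset x ` {a. a \<subseteq># m}"
    proof (cases "x \<in># a")
      case True
      then obtain b where "a = add_mset x b" by (meson mset_add)
      with a show ?thesis by simp
    next
      case False
      then have "count a x = 0" by (simp add: not_in_iff)
      have "count a y \<le> count m y" for y
        using mset_subset_eq_count[of a "add_mset x m" y] a \<open>count a x = 0\<close>
        by (cases "y = x") auto
      then have "a \<subseteq># m" by (simp add: subseteq_mset_def)
      then show ?thesis by simp
    qed
  qed
  with add show ?case by (meson finite_UnI finite_imageI finite_subset)
qed

lemma finite_mset_decomp [simp]: "finite {(a, b). a + b = (m :: 'i multiset)}"
proof -
  have "{(a, b). a + b = m} \<subseteq> {a. a \<subseteq># m} \<times> {a. a \<subseteq># m}"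
    by auto
  then show ?thesis by (rule finite_subset) (intro finite_SigmaI finite_submultisets)
qed

instantiation mps :: (type, comm_ring_1) comm_ring_1
begin

lift_definition zero_mps :: "('a, 'b) mps" is "\<lambda>_. 0" .
lift_definition one_mps :: "('a, 'b) mps" is "\<lambda>m. if m = {#} then 1 else 0" .
lift_definition plus_mps :: "('a, 'b) mps \<Rightarrow> ('a, 'b) mps \<Rightarrow> ('a, 'b) mps"
  is "\<lambda>f g m. f m + g m" .
lift_definition minus_mps :: "('a, 'b) mps \<Rightarrow> ('a, 'b) mps \<Rightarrow> ('a, 'b) mps"
  is "\<lambda>f g m. f m - g m" .
lift_definition uminus_mps :: "('a, 'b) mps \<Rightarrow> ('a, 'b) mps"
  is "\<lambda>f m. - f m" .
lift_definition times_mps :: "('a, 'b) mps \<Rightarrow> ('a, 'b) mps \<Rightarrow> ('a, 'b) mps"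
  is "\<lambda>f g m. \<Sum>(a, b)\<in>{(a, b). a + b = m}. f a * g b" .

instance
proof
  fix f g h :: "('a, 'b) mps"
  show "f + g + h = f + (g + h)" by transfer (simp add: add.assoc)
  show "f + g = g + f" by transfer (simp add: add.commute)
  show "0 + f = f" by transfer simp
  show "- f + f = 0" by transfer simp
  show "f - g = f + - g" by transfer simp
  show "(0 :: ('a, 'b) mps) \<noteq> 1" by transfer (metis zero_neq_one)
  show "(f + g) * h = f * h + g * h"
    by transfer (simp add: distrib_right sum.distrib case_prod_unfold)
  show "f * g = g * f"
  proof (transfer, rule ext)
    fix f g :: "'a multiset \<Rightarrow> 'b" and m
    show "(\<Sum>(a, b)\<in>{(a, b). a + b = m}. f a * g b) = (\<Sum>(a, b)\<in>{(a, b). a + b = m}. g a * f b)"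
      by (rule sum.reindex_bij_witness[where i = prod.swap and j = prod.swap])
         (auto simp: add.commute mult.commute)
  qed
  show "1 * f = f"
  proof (transfer, rule ext)
    fix f :: "'a multiset \<Rightarrow> 'b" and m
    have "(\<Sum>(a, b)\<in>{(a, b). a + b = m}. (if a = {#} then 1 else 0) * f b)
        = (\<Sum>(a, b)\<in>{({#} :: 'a multiset, m)}. (if a = {#} then 1 else 0) * f b)"
      by (rule sum.mono_neutral_right) (auto split: if_splits)
    then show "(\<Sum>(a, b)\<in>{(a, b). a + b = m}. (if a = {#} then 1 else 0) * f b) = f m"
      by simp
  qed
  show "f * g * h = f * (g * h)"
  proof (transfer, rule ext)
    fix f g h :: "'a multiset \<Rightarrow> 'b" and m
    have "(\<Sum>(s, c)\<in>{(s, c). s + c = m}. (\<Sum>(a, b)\<in>{(a, b). a + b = s}. f a * g b) * h c)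
        = (\<Sum>p\<in>{(s, c). s + c = m}. \<Sum>q\<in>{(a, b). a + b = fst p}. f (fst q) * g (snd q) * h (snd p))"
      by (simp add: sum_distrib_right case_prod_unfold)
    also have "\<dots> = (\<Sum>(p, q)\<in>(SIGMA p:{(s, c). s + c = m}. {(a, b). a + b = fst p}).
        f (fst q) * g (snd q) * h (snd p))"
      by (subst sum.Sigma) auto
    also have "\<dots> = (\<Sum>(p, q)\<in>(SIGMA p:{(a, s). a + s = m}. {(b, c). b + c = snd p}).
        f (fst p) * (g (fst q) * h (snd q)))"
      by (rule sum.reindex_bij_witness
            [where i = "\<lambda>((a, s), (b, c)). ((a + b, c), (a, b))"
               and j = "\<lambda>((s, c), (a, b)). ((a, b + c), (b, c))"])
         (auto simp: add.assoc mult.assoc)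
    also have "\<dots> = (\<Sum>p\<in>{(a, s). a + s = m}. \<Sum>q\<in>{(b, c). b + c = snd p}. f (fst p) * (g (fst q) * h (snd q)))"
      by (subst sum.Sigma) auto
    also have "\<dots> = (\<Sum>(a, s)\<in>{(a, s). a + s = m}. f a * (\<Sum>(b, c)\<in>{(b, c). b + c = s}. g b * h c))"
      by (simp add: sum_distrib_left case_prod_unfold)
    finally show "(\<Sum>(s, c)\<in>{(s, c). s + c = m}. (\<Sum>(a, b)\<in>{(a, b). a + b = s}. f a * g b) * h c)
        = (\<Sum>(a, s)\<in>{(a, s). a + s = m}. f a * (\<Sum>(b, c)\<in>{(b, c). b + c = s}. g b * h c))" .
  qed
qed

end

lift_definition mps_const :: "'a \<Rightarrow> ('i, 'a::zero) mps"
  is "\<lambda>c m. if m = {#} then c else 0" .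

lift_definition mps_var :: "'i \<Rightarrow> ('i, 'a::zero_neq_one) mps"
  is "\<lambda>i m. if m = {#i#} then 1 else 0" .

text \<open>
  The topology is that of coefficientwise convergence: the product topology over all monomials,
  every coefficient being taken in the discrete topology.
\<close>

instantiation mps :: (type, type) topological_space
begin

definition open_mps :: "('a, 'b) mps set \<Rightarrow> bool" where
  "open_mps S \<longleftrightarrow>
    (\<forall>f\<in>S. \<exists>M. finite M \<and> (\<forall>g. (\<forall>m\<in>M. mps_coeff g m = mps_coeff f m) \<longrightarrow> g \<in> S))"

instance
proof
  show "open (UNIV :: ('a, 'b) mps set)"
    unfolding open_mps_def by auto
next
  fix S T :: "('a, 'b) mps set"
  assume S: "open S" and T: "open T"
  show "open (S \<inter> T)"
    unfolding open_mps_def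
  proof
    fix f assume "f \<in> S \<inter> T"
    then have "f \<in> S" "f \<in> T" by auto
    from S \<open>f \<in> S\<close> obtain M
      where "finite M" "\<forall>g. (\<forall>m\<in>M. mps_coeff g m = mps_coeff f m) \<longrightarrow> g \<in> S"
      unfolding open_mps_def by blast
    moreover from T \<open>f \<in> T\<close> obtain N
      where "finite N" "\<forall>g. (\<forall>m\<in>N. mps_coeff g m = mps_coeff f m) \<longrightarrow> g \<in> T"
      unfolding open_mps_def by blast
    ultimately show "\<exists>M. finite M \<and> (\<forall>g. (\<forall>m\<in>M. mps_coeff g m = mps_coeff f m) \<longrightarrow> g \<in> S \<inter> T)"
      by (intro exI[of _ "M \<union> N"]) auto
  qed
next
  fix K :: "('a, 'b) mps set set"
  assume K: "\<forall>S\<in>K. open S"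
  show "open (\<Union>K)"
    unfolding open_mps_def
  proof
    fix f assume "f \<in> \<Union>K"
    then obtain S where S: "f \<in> S" "S \<in> K" by blast
    with K obtain M where "finite M" "\<forall>g. (\<forall>m\<in>M. mps_coeff g m = mps_coeff f m) \<longrightarrow> g \<in> S"
      unfolding open_mps_def by meson
    with S show "\<exists>M. finite M \<and> (\<forall>g. (\<forall>m\<in>M. mps_coeff g m = mps_coeff f m) \<longrightarrow> g \<in> \<Union>K)"
      by blast
  qed
qed

end

lemma open_mps_coeff_eq: "open {g. mps_coeff g m = c}"
  unfolding open_mps_def by (intro ballI exI[of _ "{m}"]) auto

instance mps :: (type, type) t2_space
proof
  fix f g :: "('a, 'b) mps"
  assume "f \<noteq> g"
  then obtain m where m: "mps_coeff f m \<noteq> mps_coeff g m"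
    using mps_ext by blast
  show "\<exists>U V. open U \<and> open V \<and> f \<in> U \<and> g \<in> V \<and> U \<inter> V = {}"
    using m
    by (intro exI[of _ "{h. mps_coeff h m = mps_coeff f m}"]
              exI[of _ "{h. mps_coeff h m = mps_coeff g m}"])
       (auto simp: open_mps_coeff_eq)
qed

lemma tendsto_mps_iff:
  "(f \<longlongrightarrow> l) F \<longleftrightarrow> (\<forall>m. eventually (\<lambda>x. mps_coeff (f x) m = mps_coeff l m) F)"
proof
  assume lim: "(f \<longlongrightarrow> l) F"
  show "\<forall>m. eventually (\<lambda>x. mps_coeff (f x) m = mps_coeff l m) F"
  proof
    fix m
    show "eventually (\<lambda>x. mps_coeff (f x) m = mps_coeff l m) F"
      using topological_tendstoD[OF lim open_mps_coeff_eq, of m "mps_coeff l m"] by simp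
  qed
next
  assume ev: "\<forall>m. eventually (\<lambda>x. mps_coeff (f x) m = mps_coeff l m) F"
  show "(f \<longlongrightarrow> l) F"
  proof (rule topological_tendstoI)
    fix S assume "open S" "l \<in> S"
    then obtain M where M: "finite M" "\<forall>g. (\<forall>m\<in>M. mps_coeff g m = mps_coeff l m) \<longrightarrow> g \<in> S"
      unfolding open_mps_def by meson
    have "eventually (\<lambda>x. \<forall>m\<in>M. mps_coeff (f x) m = mps_coeff l m) F"
      using M(1) ev by (simp add: eventually_ball_finite)
    then show "eventually (\<lambda>x. f x \<in> S) F"
      by (rule eventually_mono) (use M in blast)
  qed
qed


section \<open>Symmetric functions of an alphabet\<close>

text \<open>
  An alphabet is a family \<open>(a r)\<close> indexed by the elements \<open>r\<close> of a set \<open>I\<close>. Where \<open>I\<close> may be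
  infinite, the defining sums and products are limits over the finite subsets of \<open>I\<close>.

  For an alphabet of power series in \<open>t\<close> the power sum is formed coefficientwise in \<open>t\<close>, in the
  topology of the coefficient ring. The library's topology on the type \<open>fps\<close> is the
  \<open>t\<close>-adic one, in which an infinite alphabet need not have power sums.
\<close>

definition power_sum :: "nat \<Rightarrow> 'i set \<Rightarrow> ('i \<Rightarrow> 'r::{comm_ring_1, t2_space} fps) \<Rightarrow> 'r fps" where
  "power_sum n I a = Abs_fps (\<lambda>j. \<Sum>\<^sub>\<infinity>r\<in>I. fps_nth (a r ^ n) j)"

text \<open>
  The coefficients of \<open>s^n\<close> in the products of all \<open>1 + a r * s\<close>, respectively of all inverses
  of \<open>1 - a r * s\<close>; here \<open>fps_X\<close> plays the role of \<open>s\<close>.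
\<close>

definition elem_sym :: "nat \<Rightarrow> 'i set \<Rightarrow> ('i \<Rightarrow> 'r::{comm_ring_1, t2_space}) \<Rightarrow> 'r" where
  "elem_sym n I a =
    Lim (finite_subsets_at_top I) (\<lambda>F. fps_nth (\<Prod>r\<in>F. 1 + fps_const (a r) * fps_X) n)"

definition complete_sym :: "nat \<Rightarrow> 'i set \<Rightarrow> ('i \<Rightarrow> 'r::{comm_ring_1, t2_space}) \<Rightarrow> 'r" where
  "complete_sym n I a =
    Lim (finite_subsets_at_top I)
      (\<lambda>F. fps_nth (\<Prod>r\<in>F. fps_right_inverse (1 - fps_const (a r) * fps_X) 1) n)"

lemma fps_right_inverse_geometric:
  fixes a :: "'r::comm_ring_1"
  shows "fps_right_inverse (1 - fps_const a * fps_X) 1 = Abs_fps (\<lambda>j. a ^ j)"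
proof -
  let ?f = "1 - fps_const a * fps_X" and ?g = "Abs_fps (\<lambda>j. a ^ j)"
  have inv: "?f * fps_right_inverse ?f 1 = 1"
    by (rule fps_right_inverse) simp
  have geo: "?f * ?g = 1"
  proof (rule fps_ext)
    fix n
    show "fps_nth (?f * ?g) n = fps_nth 1 n"
      by (cases n) (simp_all add: left_diff_distrib mult.assoc)
  qed
  have "fps_right_inverse ?f 1 = (?f * ?g) * fps_right_inverse ?f 1"
    by (simp only: geo mult_1_left)
  also have "\<dots> = ?g * (?f * fps_right_inverse ?f 1)"
    by (simp only: mult.assoc mult.left_commute)
  finally show ?thesis by (simp only: inv mult_1_right)
qed


section \<open>Integer partitions\<close>

text \<open>
  A partition is the multiset of its nonzero parts: \<open>sum_mset \<mu>\<close> is its weight, \<open>size \<mu>\<close> its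
  length and \<open>count \<mu> i\<close> the multiplicity of the part \<open>i\<close>.
\<close>

definition is_partition :: "nat multiset \<Rightarrow> bool" where
  "is_partition \<mu> \<longleftrightarrow> 0 \<notin># \<mu>"

definition elem_sym_part :: "nat multiset \<Rightarrow> 'i set \<Rightarrow> ('i \<Rightarrow> 'r::{comm_ring_1, t2_space}) \<Rightarrow> 'r" where
  "elem_sym_part \<mu> I a = (\<Prod>n\<in>#\<mu>. elem_sym n I a)"

definition complete_sym_part :: "nat multiset \<Rightarrow> 'i set \<Rightarrow> ('i \<Rightarrow> 'r::{comm_ring_1, t2_space}) \<Rightarrow> 'r" where
  "complete_sym_part \<mu> I a = (\<Prod>n\<in>#\<mu>. complete_sym n I a)"


section \<open>The alphabet of the fractions \<open>x / (1 - t x)\<close>\<close>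

text \<open>
  Power series in \<open>t\<close> whose coefficients are power series in the indeterminates \<open>x\<close>;
  \<open>fps_X\<close> plays the role of \<open>t\<close>.
\<close>

definition frac_alphabet :: "'i \<Rightarrow> ('i, 'a::comm_ring_1) mps fps" where
  "frac_alphabet r =
    fps_const (mps_var r) * fps_right_inverse (1 - fps_X * fps_const (mps_var r)) 1"


section \<open>Convergence for the alphabets in question\<close>

lemma mps_coeff_mult:
  "mps_coeff (f * g) m = (\<Sum>(a, b)\<in>{(a, b). a + b = m}. mps_coeff f a * mps_coeff g b)"
  by transfer simp

lemma mps_coeff_0 [simp]: "mps_coeff 0 m = 0"
  by transfer simp

lemma mps_coeff_sum: "mps_coeff (sum f A) m = (\<Sum>x\<in>A. mps_coeff (f x) m)"
proof (induction A rule: infinite_finite_induct)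
  case (insert x A)
  then show ?case by (simp add: plus_mps.rep_eq)
qed simp_all

lemma mps_coeff_mult_var_eq_0:
  assumes "r \<notin># m"
  shows "mps_coeff (f * mps_var r) m = 0"
  unfolding mps_coeff_mult using assms
  by (intro sum.neutral) (auto simp: mps_var.rep_eq)

lemma mps_coeff_mult_var_power_eq_0:
  assumes "r \<notin># m" "j > 0"
  shows "mps_coeff (f * mps_var r ^ j) m = 0"
proof -
  from assms obtain i where "j = Suc i" by (cases j) auto
  then have "f * mps_var r ^ j = (f * mps_var r ^ i) * mps_var r"
    by (simp add: ac_simps)
  then show ?thesis using assms by (simp add: mps_coeff_mult_var_eq_0)
qed

lemma prod_coeff_stable:
  fixes G :: "'i \<Rightarrow> ('i, 'a::comm_ring_1) mps fps"
  assumes G0: "\<And>r. fps_nth (G r) 0 = 1"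
    and G: "\<And>r j. j > 0 \<Longrightarrow> \<exists>c. fps_nth (G r) j = c * mps_var r"
    and "finite D" "finite F" "D \<inter> F = {}" "D \<inter> set_mset m = {}"
  shows "mps_coeff (fps_nth (prod G (F \<union> D)) n) m = mps_coeff (fps_nth (prod G F) n) m"
  using assms(3,5,6)
proof (induction D rule: finite_induct)
  case (insert r D)
  let ?P = "prod G (F \<union> D)"
  have "prod G (F \<union> insert r D) = ?P * G r"
    using insert \<open>finite F\<close> by (simp add: mult.commute)
  then have "mps_coeff (fps_nth (prod G (F \<union> insert r D)) n) m
      = (\<Sum>i=0..n. mps_coeff (fps_nth ?P i * fps_nth (G r) (n - i)) m)"
    by (simp add: fps_mult_nth mps_coeff_sum)
  also have "\<dots> = (\<Sum>i\<in>{n}. mps_coeff (fps_nth ?P i * fps_nth (G r) (n - i)) m)"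
  proof (rule sum.mono_neutral_right)
    show "\<forall>i\<in>{0..n} - {n}. mps_coeff (fps_nth ?P i * fps_nth (G r) (n - i)) m = 0"
    proof
      fix i assume "i \<in> {0..n} - {n}"
      then obtain c where "fps_nth (G r) (n - i) = c * mps_var r"
        using G[of "n - i" r] by auto
      moreover have "r \<notin># m" using insert.prems by auto
      ultimately show "mps_coeff (fps_nth ?P i * fps_nth (G r) (n - i)) m = 0"
        by (simp add: mps_coeff_mult_var_eq_0 flip: mult.assoc)
    qed
  qed auto
  finally show ?case using insert by (simp add: G0)
qed simp

lemma prod_coeff_tendsto:
  fixes G :: "'i \<Rightarrow> ('i, 'a::comm_ring_1) mps fps" and n :: nat
  assumes G0: "\<And>r. fps_nth (G r) 0 = 1"
    and G: "\<And>r j. j > 0 \<Longrightarrow> \<exists>c. fps_nth (G r) j = c * mps_var r"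
  defines "P \<equiv> \<lambda>F. fps_nth (prod G F) n"
  shows "(P \<longlongrightarrow> Lim (finite_subsets_at_top I) P) (finite_subsets_at_top I)"
proof -
  define l where "l = Abs_mps (\<lambda>m. mps_coeff (P (I \<inter> set_mset m)) m)"
  have "(P \<longlongrightarrow> l) (finite_subsets_at_top I)"
    unfolding tendsto_mps_iff eventually_finite_subsets_at_top
  proof (intro allI exI conjI impI)
    fix m :: "'i multiset"
    show "finite (I \<inter> set_mset m)" "I \<inter> set_mset m \<subseteq> I" by auto
    fix F assume F: "finite F \<and> I \<inter> set_mset m \<subseteq> F \<and> F \<subseteq> I"
    let ?D = "F - I \<inter> set_mset m"
    have "F = (I \<inter> set_mset m) \<union> ?D" using F by auto
    then have "mps_coeff (P F) m = mps_coeff (fps_nth (prod G ((I \<inter> set_mset m) \<union> ?D)) n) m"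
      by (simp add: P_def)
    also have "\<dots> = mps_coeff (P (I \<inter> set_mset m)) m"
      unfolding P_def by (rule prod_coeff_stable) (use F G0 G in auto)
    finally show "mps_coeff (P F) m = mps_coeff l m"
      by (simp add: l_def Abs_mps_inverse)
  qed
  moreover from this have "Lim (finite_subsets_at_top I) P = l"
    by (intro tendsto_Lim) auto
  ultimately show ?thesis by simp
qed

lemma elem_sym_tendsto:
  "((\<lambda>F. fps_nth (\<Prod>r\<in>F. 1 + fps_const (mps_var r) * fps_X) n)
     \<longlongrightarrow> (elem_sym n I mps_var :: ('i, 'a::comm_ring_1) mps)) (finite_subsets_at_top I)"
  unfolding elem_sym_def
proof (rule prod_coeff_tendsto)
  fix r :: 'i and j :: nat
  assume "j > 0"
  then show "\<exists>c. fps_nth (1 + fps_const (mps_var r :: ('i, 'a) mps) * fps_X) j = c * mps_var r"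
    by (intro exI[of _ "if j = 1 then 1 else 0"]) auto
qed simp

lemma complete_sym_tendsto:
  "((\<lambda>F. fps_nth (\<Prod>r\<in>F. fps_right_inverse (1 - fps_const (mps_var r) * fps_X) 1) n)
     \<longlongrightarrow> (complete_sym n I mps_var :: ('i, 'a::comm_ring_1) mps)) (finite_subsets_at_top I)"
  unfolding complete_sym_def
proof (rule prod_coeff_tendsto)
  fix r :: 'i and j :: nat
  assume "j > 0"
  then show "\<exists>c. fps_nth (fps_right_inverse (1 - fps_const (mps_var r :: ('i, 'a) mps) * fps_X) 1) j
      = c * mps_var r"
    by (cases j) (auto simp only: fps_right_inverse_geometric fps_nth_Abs_fps power_Suc2)
qed (simp add: fps_right_inverse_geometric)

lemma frac_alphabet_eq: "frac_alphabet r = Abs_fps (\<lambda>j. mps_var r ^ Suc j)"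
proof -
  have "frac_alphabet r = fps_const (mps_var r) * Abs_fps (\<lambda>j. mps_var r ^ j)"
    unfolding frac_alphabet_def mult.commute[of fps_X] fps_right_inverse_geometric ..
  then show ?thesis by (simp add: fps_eq_iff)
qed

lemma frac_alphabet_mult:
  "frac_alphabet r * (1 - fps_X * fps_const (mps_var r :: ('i, 'a::comm_ring_1) mps))
    = fps_const (mps_var r)"
proof -
  let ?f = "1 - fps_X * fps_const (mps_var r :: ('i, 'a) mps)"
  have "?f * fps_right_inverse ?f 1 = 1"
    by (rule fps_right_inverse) simp
  then show ?thesis
    unfolding frac_alphabet_def
    by (simp only: mult.assoc mult.commute[of "fps_right_inverse ?f 1"] mult_1_right)
qed

lemma frac_alphabet_power_summable:
  assumes "n > 0"
  shows "(\<lambda>r. fps_nth (frac_alphabet r ^ n :: ('i, 'a::comm_ring_1) mps fps) j) summable_on I"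
proof -
  let ?c = "\<lambda>r. fps_nth (frac_alphabet r ^ n :: ('i, 'a) mps fps) j"
  have zero: "mps_coeff (?c r) m = 0" if "r \<notin># m" for r m
  proof -
    obtain i where "n = Suc i" using assms by (cases n) auto
    then have "frac_alphabet r ^ n = frac_alphabet r ^ i *
        fps_right_inverse (1 - fps_X * fps_const (mps_var r)) 1 * fps_const (mps_var r :: ('i, 'a) mps)"
      by (simp add: frac_alphabet_def ac_simps)
    then show ?thesis using that by (simp add: mps_coeff_mult_var_eq_0)
  qed
  define l where "l = Abs_mps (\<lambda>m. \<Sum>r\<in>I \<inter> set_mset m. mps_coeff (?c r) m)"
  have "(?c has_sum l) I"
    unfolding has_sum_def tendsto_mps_iff eventually_finite_subsets_at_top
  proof (intro allI exI conjI impI)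
    fix m :: "'i multiset"
    show "finite (I \<inter> set_mset m)" "I \<inter> set_mset m \<subseteq> I" by auto
    fix F assume F: "finite F \<and> I \<inter> set_mset m \<subseteq> F \<and> F \<subseteq> I"
    have "(\<Sum>r\<in>F. mps_coeff (?c r) m) = (\<Sum>r\<in>I \<inter> set_mset m. mps_coeff (?c r) m)"
      by (rule sum.mono_neutral_right) (use F zero in auto)
    then show "mps_coeff (sum ?c F) m = mps_coeff l m"
      by (simp add: l_def Abs_mps_inverse mps_coeff_sum)
  qed
  then show ?thesis unfolding summable_on_def by blast
qed

end

theory Submission
  imports Defs "HOL-Combinatorics.Multiset_Permutations"
begin

text \<open>
  The coefficient of \<open>t^j\<close> in \<open>x^k / (1 - t x)^k\<close> is \<open>(k + j - 1 choose j) x^(k + j)\<close>, so the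
  coefficient of \<open>t^j\<close> in the power sum of the fractions is \<open>(n - 1 choose n - k) p_n\<close> with
  \<open>n = k + j\<close>, where \<open>p_n\<close> is the power sum of the indeterminates themselves
  (\<open>power_sum_frac_alphabet_nth\<close>). Since \<open>n (n - 1 choose n - k) = k (n choose k)\<close>, both identities
  are, coefficient by coefficient in \<open>t\<close>, Waring's formulas for \<open>p_n\<close>
  (\<open>waring_elem_sym\<close>, \<open>waring_complete_sym\<close>); the sums over \<open>\<mu>\<close> converge \<open>t\<close>-adically because
  only the finitely many partitions of \<open>k + j\<close> contribute to \<open>t^j\<close>
  (\<open>power_sum_frac_alphabet_of_waring\<close>).

  Waring's formulas in turn say that the generating series of the power sums is a logarithmic
  derivative. If \<open>f\<close> is the generating series of the \<open>e_n\<close> or of the \<open>h_n\<close>, then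
  \<open>f'/f\<close> is \<open>\<Sum>j. (-1)^j p_(j+1) s^j\<close>, respectively \<open>\<Sum>j. p_(j+1) s^j\<close>. These are Newton's
  identities; they are clear for one indeterminate, pass to finite products, and then to the limit
  (\<open>newton_elem_sym\<close>, \<open>newton_complete_sym\<close>). On the other hand
  \<open>f'/f = (\<Sum>l\<ge>1. (-1)^(l-1) (f - 1)^l / l)'\<close>, and the coefficient of \<open>s^n\<close> in \<open>(f - 1)^l\<close> is
  the sum over all compositions of \<open>n\<close> into \<open>l\<close> parts of the products of the coefficients of \<open>f\<close>.
  A partition of length \<open>l\<close> arises from \<open>l! / \<Prod>i. m_i!\<close> compositions, and division by \<open>l\<close> turns \<open>l!\<close>
  into \<open>(l - 1)!\<close> (\<open>waring_log_deriv\<close>).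
\<close>


section \<open>Coefficientwise limits and scalars\<close>

lemma tendsto_mps_mult:
  fixes f g :: "'x \<Rightarrow> ('i, 'a::comm_ring_1) mps"
  assumes "(f \<longlongrightarrow> a) F" "(g \<longlongrightarrow> b) F"
  shows "((\<lambda>x. f x * g x) \<longlongrightarrow> a * b) F"
  unfolding tendsto_mps_iff
proof
  fix m
  have "eventually (\<lambda>x. \<forall>p\<in>{(u, v). u + v = m}. mps_coeff (f x) (fst p) = mps_coeff a (fst p)
      \<and> mps_coeff (g x) (snd p) = mps_coeff b (snd p)) F"
    using assms unfolding tendsto_mps_iff
    by (intro eventually_ball_finite ballI eventually_conj) auto
  then show "eventually (\<lambda>x. mps_coeff (f x * g x) m = mps_coeff (a * b) m) F"
    by eventually_elim (auto simp: mps_coeff_mult intro!: sum.cong)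
qed

lemma tendsto_mps_sum:
  fixes f :: "'x \<Rightarrow> 'y \<Rightarrow> ('i, 'a::comm_ring_1) mps"
  assumes "finite A" "\<And>y. y \<in> A \<Longrightarrow> ((\<lambda>x. f x y) \<longlongrightarrow> a y) F"
  shows "((\<lambda>x. \<Sum>y\<in>A. f x y) \<longlongrightarrow> (\<Sum>y\<in>A. a y)) F"
  unfolding tendsto_mps_iff
proof
  fix m
  have "eventually (\<lambda>x. \<forall>y\<in>A. mps_coeff (f x y) m = mps_coeff (a y) m) F"
    using assms unfolding tendsto_mps_iff by (intro eventually_ball_finite) auto
  then show "eventually (\<lambda>x. mps_coeff (\<Sum>y\<in>A. f x y) m = mps_coeff (\<Sum>y\<in>A. a y) m) F"
    by eventually_elim (auto simp: mps_coeff_sum intro!: sum.cong)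
qed

lemma mps_const_1: "mps_const 1 = 1"
  by transfer auto

lemma mps_const_add:
  "mps_const (c + d :: 'a::comm_ring_1) = (mps_const c + mps_const d :: ('i, 'a) mps)"
  by transfer auto

lemma mps_const_uminus:
  "mps_const (- c :: 'a::comm_ring_1) = (- mps_const c :: ('i, 'a) mps)"
  by transfer auto

lemma mps_const_mult:
  "mps_const (c * d :: 'a::comm_ring_1) = (mps_const c * mps_const d :: ('i, 'a) mps)"
proof (rule mps_ext)
  fix m :: "'i multiset"
  have "(\<Sum>(a, b)\<in>{(a, b). a + b = m}. (if a = {#} then c else 0) * (if b = {#} then d else 0))
      = (\<Sum>(a, b)\<in>{({#} :: 'i multiset, m)}. (if a = {#} then c else 0) * (if b = {#} then d else 0))"
    by (rule sum.mono_neutral_right) (auto split: if_splits)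
  then show "mps_coeff (mps_const (c * d)) m = mps_coeff (mps_const c * mps_const d) m"
    by (simp add: mps_coeff_mult mps_const.rep_eq)
qed

lemma mps_const_of_nat:
  "mps_const (of_nat n :: 'a::comm_ring_1) = (of_nat n :: ('i, 'a) mps)"
proof (induction n)
  case 0
  show ?case by (rule mps_ext) (simp add: mps_const.rep_eq)
qed (simp add: mps_const_add mps_const_1)

lemma mps_const_minus_one_power:
  "mps_const ((- 1) ^ n :: 'a::comm_ring_1) = ((- 1) ^ n :: ('i, 'a) mps)"
  by (induction n) (simp_all add: mps_const_1 mps_const_uminus)


section \<open>Partitions and powers of a series\<close>

lemma size_le_sum_mset_partition:
  assumes "is_partition \<mu>"
  shows "size \<mu> \<le> sum_mset \<mu>"
  using assms by (induction \<mu>) (auto simp: is_partition_def)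

lemma mset_natpermute: "{\<mu>. sum_mset \<mu> = n \<and> size \<mu> = l} = mset ` natpermute n l"
proof (intro equalityI subsetI)
  fix \<mu> :: "nat multiset"
  assume \<mu>: "\<mu> \<in> {\<mu>. sum_mset \<mu> = n \<and> size \<mu> = l}"
  obtain xs where "mset xs = \<mu>" using ex_mset by blast
  with \<mu> show "\<mu> \<in> mset ` natpermute n l"
    by (auto simp: natpermute_def simp flip: sum_mset_sum_list size_mset)
qed (auto simp: natpermute_def sum_mset_sum_list)

lemma finite_partitions_of: "finite {\<mu>. is_partition \<mu> \<and> sum_mset \<mu> = n}"
proof (rule finite_subset)
  show "{\<mu>. is_partition \<mu> \<and> sum_mset \<mu> = n} \<subseteq> (\<Union>l\<le>n. {\<mu>. sum_mset \<mu> = n \<and> size \<mu> = l})"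
    using size_le_sum_mset_partition by auto
  show "finite (\<Union>l\<le>n. {\<mu>. sum_mset \<mu> = n \<and> size \<mu> = l})"
    by (simp add: mset_natpermute natpermute_finite)
qed

text \<open>
  Expanding the power gives one term for each list of exponents; lists that are permutations of
  each other give the same product, and are collected.
\<close>

lemma fps_power_nth_multisets:
  fixes f :: "'r::comm_ring_1 fps"
  shows "fps_nth (f ^ l) n = (\<Sum>\<mu> | sum_mset \<mu> = n \<and> size \<mu> = l.
    of_nat (card (permutations_of_multiset \<mu>)) * (\<Prod>i\<in>#\<mu>. fps_nth f i))"
proof -
  let ?g = "\<lambda>xs. \<Prod>i\<in>#mset xs. fps_nth f i"
  have "fps_nth (f ^ l) n = (\<Sum>xs\<in>natpermute n l. ?g xs)"
  proof (cases l)
    case 0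
    then show ?thesis by (auto simp: natpermute_0)
  next
    case (Suc m)
    have "(\<Prod>j\<in>{0..m}. fps_nth f (xs ! j)) = ?g xs" if "xs \<in> natpermute n (Suc m)" for xs
    proof -
      have "length xs = Suc m" using that by (simp add: natpermute_def)
      then have "prod_list (map (fps_nth f) xs) = (\<Prod>j\<in>{0..m}. fps_nth f (xs ! j))"
        by (simp add: prod.list_conv_set_nth atLeastLessThanSuc_atLeastAtMost)
      then show ?thesis by (simp add: prod_mset_prod_list flip: mset_map)
    qed
    then show ?thesis
      by (simp add: Suc fps_power_nth_Suc del: power_Suc)
  qed
  also have "\<dots> = (\<Sum>\<mu>\<in>mset ` natpermute n l. \<Sum>xs\<in>{xs \<in> natpermute n l. mset xs = \<mu>}. ?g xs)"
    by (rule sum.image_gen) (rule natpermute_finite)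
  also have "\<dots> = (\<Sum>\<mu>\<in>mset ` natpermute n l.
      of_nat (card (permutations_of_multiset \<mu>)) * (\<Prod>i\<in>#\<mu>. fps_nth f i))"
  proof (rule sum.cong[OF refl])
    fix \<mu> assume "\<mu> \<in> mset ` natpermute n l"
    then have "{xs \<in> natpermute n l. mset xs = \<mu>} = permutations_of_multiset \<mu>"
      unfolding mset_natpermute[symmetric] permutations_of_multiset_def
      by (auto simp: natpermute_def sum_mset_sum_list)
    moreover have "(\<Sum>xs\<in>permutations_of_multiset \<mu>. ?g xs)
        = (\<Sum>xs\<in>permutations_of_multiset \<mu>. \<Prod>i\<in>#\<mu>. fps_nth f i)"
      by (rule sum.cong) (auto simp: permutations_of_multiset_def)
    ultimately show "(\<Sum>xs\<in>{xs \<in> natpermute n l. mset xs = \<mu>}. ?g xs)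
        = of_nat (card (permutations_of_multiset \<mu>)) * (\<Prod>i\<in>#\<mu>. fps_nth f i)"
      by simp
  qed
  finally show ?thesis by (simp only: mset_natpermute)
qed

text \<open>
  Removing the constant term kills the multisets that contain \<open>0\<close>, so only partitions remain,
  and for these \<open>f - 1\<close> and \<open>f\<close> have the same coefficients.
\<close>

lemma fps_power_minus_one_nth:
  fixes f :: "'r::comm_ring_1 fps"
  assumes "fps_nth f 0 = 1"
  shows "fps_nth ((f - 1) ^ l) n = (\<Sum>\<mu> | is_partition \<mu> \<and> sum_mset \<mu> = n \<and> size \<mu> = l.
    of_nat (card (permutations_of_multiset \<mu>)) * (\<Prod>i\<in>#\<mu>. fps_nth f i))"
proof -
  let ?c = "\<lambda>\<mu>. of_nat (card (permutations_of_multiset \<mu>)) :: 'r"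
  have "fps_nth ((f - 1) ^ l) n = (\<Sum>\<mu> | sum_mset \<mu> = n \<and> size \<mu> = l.
      ?c \<mu> * (\<Prod>i\<in>#\<mu>. fps_nth (f - 1) i))"
    by (rule fps_power_nth_multisets)
  also have "\<dots> = (\<Sum>\<mu> | is_partition \<mu> \<and> sum_mset \<mu> = n \<and> size \<mu> = l.
      ?c \<mu> * (\<Prod>i\<in>#\<mu>. fps_nth (f - 1) i))"
  proof (rule sum.mono_neutral_right)
    have zero: "(\<Prod>i\<in>#\<mu>. fps_nth (f - 1) i) = 0" if "\<not> is_partition \<mu>" for \<mu>
    proof -
      from that obtain \<nu> where "\<mu> = add_mset 0 \<nu>"
        unfolding is_partition_def by (meson mset_add)
      then show ?thesis using assms by simp
    qed
    show "\<forall>\<mu>\<in>{\<mu>. sum_mset \<mu> = n \<and> size \<mu> = l}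
        - {\<mu>. is_partition \<mu> \<and> sum_mset \<mu> = n \<and> size \<mu> = l}.
        ?c \<mu> * (\<Prod>i\<in>#\<mu>. fps_nth (f - 1) i) = 0"
    proof
      fix \<mu> assume "\<mu> \<in> {\<mu>. sum_mset \<mu> = n \<and> size \<mu> = l}
        - {\<mu>. is_partition \<mu> \<and> sum_mset \<mu> = n \<and> size \<mu> = l}"
      then have "\<not> is_partition \<mu>" by auto
      then show "?c \<mu> * (\<Prod>i\<in>#\<mu>. fps_nth (f - 1) i) = 0"
        by (simp only: zero[OF \<open>\<not> is_partition \<mu>\<close>] mult_zero_right)
    qed
  qed (simp add: mset_natpermute natpermute_finite, blast)
  also have "\<dots> = (\<Sum>\<mu> | is_partition \<mu> \<and> sum_mset \<mu> = n \<and> size \<mu> = l.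
      ?c \<mu> * (\<Prod>i\<in>#\<mu>. fps_nth f i))"
  proof (rule sum.cong[OF refl])
    fix \<mu> assume "\<mu> \<in> {\<mu>. is_partition \<mu> \<and> sum_mset \<mu> = n \<and> size \<mu> = l}"
    then have "0 \<notin># \<mu>" by (simp add: is_partition_def)
    then have "i \<noteq> 0" if "i \<in># \<mu>" for i
      using that by metis
    then have "image_mset (fps_nth (f - 1)) \<mu> = image_mset (fps_nth f) \<mu>"
      by (intro image_mset_cong) simp
    then show "?c \<mu> * (\<Prod>i\<in>#\<mu>. fps_nth (f - 1) i) = ?c \<mu> * (\<Prod>i\<in>#\<mu>. fps_nth f i)"
      by (simp only:)
  qed
  finally show ?thesis .
qed

lemma card_permutations_of_multiset_field:
  "(of_nat (card (permutations_of_multiset \<mu>)) :: 'a::field_char_0)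
    = fact (size \<mu>) / (\<Prod>i\<in>set_mset \<mu>. fact (count \<mu> i))"
proof -
  have "of_nat (card (permutations_of_multiset \<mu>) * (\<Prod>i\<in>set_mset \<mu>. fact (count \<mu> i)))
      = (of_nat (fact (size \<mu>)) :: 'a)"
    by (simp only: card_permutations_of_multiset_aux)
  then show ?thesis
    by (simp add: field_simps)
qed


section \<open>Waring's formula for a logarithmic derivative\<close>

text \<open>
  The geometric series for \<open>f' / (1 + (f - 1))\<close>, with its remainder: iterate \<open>p = f' - (f - 1) p\<close>.
  Keeping the remainder makes an infinite sum and an inverse of \<open>f\<close> superfluous, as it does not
  reach coefficients below \<open>N\<close> if \<open>f\<close> has constant term \<open>1\<close>.
\<close>

lemma log_deriv_expansion:
  fixes f p :: "'r::comm_ring_1 fps"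
  assumes "f * p = fps_deriv f"
  shows "p = (\<Sum>l<N. (- 1) ^ l * ((f - 1) ^ l * fps_deriv f)) + (- 1) ^ N * ((f - 1) ^ N * p)"
proof (induction N)
  case (Suc N)
  have p: "p = fps_deriv f - (f - 1) * p"
    by (simp add: left_diff_distrib assms)
  have "(f - 1) ^ N * p = (f - 1) ^ N * fps_deriv f - (f - 1) ^ Suc N * p"
    by (subst p) (simp add: algebra_simps)
  with Suc show ?case by (simp add: algebra_simps)
qed simp

text \<open>
  Compare coefficients in \<open>((f - 1)^(l + 1))' = (l + 1) (f - 1)^l f'\<close>. The division by \<open>l + 1\<close> has
  to be made with a constant from the field, because the power series ring is not a field.
\<close>

lemma power_mult_deriv_nth:
  fixes f :: "('i, 'a::field_char_0) mps fps"
  assumes "n > 0"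
  shows "fps_nth ((f - 1) ^ l * fps_deriv f) (n - 1)
    = mps_const (of_nat n / of_nat (Suc l)) * fps_nth ((f - 1) ^ Suc l) n"
proof -
  let ?y = "fps_nth ((f - 1) ^ l * fps_deriv f) (n - 1)"
  have "fps_deriv ((f - 1) ^ Suc l) = fps_const (of_nat (Suc l)) * ((f - 1) ^ l * fps_deriv f)"
    unfolding fps_deriv_power by (simp add: algebra_simps)
  from arg_cong[OF this, of "\<lambda>h. fps_nth h (n - 1)"]
  have "of_nat n * fps_nth ((f - 1) ^ Suc l) n = of_nat (Suc l) * ?y"
    using assms by (simp del: power_Suc of_nat_Suc)
  then have scaled: "of_nat (Suc l) * ?y = of_nat n * fps_nth ((f - 1) ^ Suc l) n" ..
  have inv: "mps_const (1 / of_nat (Suc l)) * of_nat (Suc l) = (1 :: ('i, 'a) mps)"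
    by (simp add: mps_const_1 del: of_nat_Suc flip: mps_const_of_nat mps_const_mult)
  have quot: "mps_const (1 / of_nat (Suc l)) * of_nat n
      = (mps_const (of_nat n / of_nat (Suc l)) :: ('i, 'a) mps)"
    by (simp del: of_nat_Suc flip: mps_const_of_nat mps_const_mult)
  have "?y = mps_const (1 / of_nat (Suc l)) * of_nat (Suc l) * ?y"
    by (simp only: inv mult_1_left)
  also have "\<dots> = mps_const (1 / of_nat (Suc l)) * of_nat n * fps_nth ((f - 1) ^ Suc l) n"
    by (simp only: mult.assoc scaled)
  finally show ?thesis
    by (simp only: quot)
qed

lemma waring_log_deriv:
  fixes f p :: "('i, 'a::field_char_0) mps fps"
  assumes f0: "fps_nth f 0 = 1" and p: "f * p = fps_deriv f" and n: "n > 0"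
  shows "fps_nth p (n - 1) = (\<Sum>\<mu> | is_partition \<mu> \<and> sum_mset \<mu> = n.
    mps_const ((- 1) ^ (size \<mu> - 1) *
      (of_nat n * fact (size \<mu> - 1) / (\<Prod>i\<in>set_mset \<mu>. fact (count \<mu> i))))
    * (\<Prod>i\<in>#\<mu>. fps_nth f i))"
proof -
  let ?P = "{\<mu>. is_partition \<mu> \<and> sum_mset \<mu> = n}"
  let ?t = "\<lambda>\<mu>. mps_const ((- 1) ^ (size \<mu> - 1) *
      (of_nat n * fact (size \<mu> - 1) / (\<Prod>i\<in>set_mset \<mu>. fact (count \<mu> i))))
    * (\<Prod>i\<in>#\<mu>. fps_nth f i)"
  have sign: "fps_nth ((- 1) ^ l * g) j = (- 1) ^ l * fps_nth g j"
    for l j and g :: "('i, 'a) mps fps"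
    by (cases "even l") simp_all
  have tail: "fps_nth ((f - 1) ^ n * p) (n - 1) = 0"
    unfolding fps_mult_nth
    by (intro sum.neutral) (use f0 n startsby_zero_power_prefix[of "f - 1" n] in auto)
  have "fps_nth p (n - 1)
      = (\<Sum>l<n. (- 1) ^ l * fps_nth ((f - 1) ^ l * fps_deriv f) (n - 1))"
    by (subst log_deriv_expansion[OF p, of n]) (simp add: fps_sum_nth sign tail del: One_nat_def)
  also have "\<dots> = (\<Sum>l<n. \<Sum>\<mu>\<in>{\<mu> \<in> ?P. size \<mu> - 1 = l}. ?t \<mu>)"
  proof (rule sum.cong[OF refl])
    fix l
    have eq: "{\<mu> \<in> ?P. size \<mu> - 1 = l}
        = {\<mu>. is_partition \<mu> \<and> sum_mset \<mu> = n \<and> size \<mu> = Suc l}"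
    proof -
      have "size \<mu> - 1 = l \<longleftrightarrow> size \<mu> = Suc l" if "sum_mset \<mu> = n" for \<mu>
        using that n by (cases "size \<mu>") auto
      then show ?thesis by blast
    qed
    have "(- 1) ^ l * fps_nth ((f - 1) ^ l * fps_deriv f) (n - 1)
        = (\<Sum>\<mu> | is_partition \<mu> \<and> sum_mset \<mu> = n \<and> size \<mu> = Suc l.
            (- 1) ^ l * (mps_const (of_nat n / of_nat (Suc l))
              * (of_nat (card (permutations_of_multiset \<mu>)) * (\<Prod>i\<in>#\<mu>. fps_nth f i))))"
      unfolding power_mult_deriv_nth[OF n] fps_power_minus_one_nth[OF f0]
      by (simp only: sum_distrib_left)
    also have "\<dots> = (\<Sum>\<mu> | is_partition \<mu> \<and> sum_mset \<mu> = n \<and> size \<mu> = Suc l. ?t \<mu>)"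
    proof (rule sum.cong[OF refl])
      fix \<mu> assume "\<mu> \<in> {\<mu>. is_partition \<mu> \<and> sum_mset \<mu> = n \<and> size \<mu> = Suc l}"
      then have l: "size \<mu> = Suc l" by simp
      have c: "(- 1) ^ l * (of_nat n / of_nat (Suc l) * of_nat (card (permutations_of_multiset \<mu>)))
          = ((- 1) ^ (size \<mu> - 1) * (of_nat n * fact (size \<mu> - 1)
              / (\<Prod>i\<in>set_mset \<mu>. fact (count \<mu> i))) :: 'a)"
        unfolding card_permutations_of_multiset_field l
        by (simp add: field_simps del: of_nat_Suc)
      have "(- 1) ^ l * (mps_const (of_nat n / of_nat (Suc l))
          * (of_nat (card (permutations_of_multiset \<mu>)) * (\<Prod>i\<in>#\<mu>. fps_nth f i)))
        = mps_const ((- 1) ^ l * (of_nat n / of_nat (Suc l) * of_nat (card (permutations_of_multiset \<mu>))))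
          * (\<Prod>i\<in>#\<mu>. fps_nth f i)"
        by (simp only: mps_const_mult mps_const_minus_one_power mps_const_of_nat mult.assoc)
      then show "(- 1) ^ l * (mps_const (of_nat n / of_nat (Suc l))
          * (of_nat (card (permutations_of_multiset \<mu>)) * (\<Prod>i\<in>#\<mu>. fps_nth f i))) = ?t \<mu>"
        by (simp only: c)
    qed
    finally show "(- 1) ^ l * fps_nth ((f - 1) ^ l * fps_deriv f) (n - 1)
        = (\<Sum>\<mu>\<in>{\<mu> \<in> ?P. size \<mu> - 1 = l}. ?t \<mu>)"
      by (simp only: eq)
  qed
  also have "\<dots> = sum ?t ?P"
  proof (rule sum.group)
    show "(\<lambda>\<mu>. size \<mu> - 1) ` ?P \<subseteq> {..<n}"
      using size_le_sum_mset_partition n by fastforce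
  qed (simp_all add: finite_partitions_of)
  finally show ?thesis .
qed


section \<open>Newton's identities\<close>

text \<open>
  Logarithmic derivatives turn products into sums; writing \<open>Q = G'/G\<close> as \<open>G Q = G'\<close> avoids
  division.
\<close>

lemma prod_log_deriv:
  fixes G Q :: "'x \<Rightarrow> 'r::comm_ring_1 fps"
  assumes "\<And>r. G r * Q r = fps_deriv (G r)"
  shows "prod G F * sum Q F = fps_deriv (prod G F)"
proof (induction F rule: infinite_finite_induct)
  case (insert r F)
  have "prod G (insert r F) * sum Q (insert r F) = prod G F * (G r * Q r) + G r * (prod G F * sum Q F)"
    using insert.hyps by (simp add: algebra_simps)
  also have "\<dots> = fps_deriv (prod G (insert r F))"
    using insert by (simp add: assms algebra_simps)
  finally show ?case .
qed simp_all

text \<open>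
  The finite identity passes to the limit because each coefficient of it is a polynomial expression
  in finitely many coefficients, and multiplication is continuous for coefficientwise convergence.
\<close>

lemma limit_log_deriv:
  fixes G Q :: "'x \<Rightarrow> ('i, 'a::comm_ring_1) mps fps"
  assumes GQ: "\<And>r. G r * Q r = fps_deriv (G r)"
    and f: "\<And>n. ((\<lambda>F. fps_nth (prod G F) n) \<longlongrightarrow> fps_nth f n) (finite_subsets_at_top I)"
    and p: "\<And>n. ((\<lambda>r. fps_nth (Q r) n) has_sum fps_nth p n) I"
  shows "f * p = fps_deriv f"
proof (rule fps_ext)
  fix n
  have p': "((\<lambda>F. fps_nth (sum Q F) n) \<longlongrightarrow> fps_nth p n) (finite_subsets_at_top I)" for n
    using p[of n] by (simp add: has_sum_def fps_sum_nth)
  have "((\<lambda>F. fps_nth (prod G F * sum Q F) n) \<longlongrightarrow> fps_nth (f * p) n) (finite_subsets_at_top I)"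
    unfolding fps_mult_nth by (intro tendsto_mps_sum tendsto_mps_mult f p') auto
  moreover have "((\<lambda>F. of_nat (n + 1) * fps_nth (prod G F) (n + 1))
      \<longlongrightarrow> of_nat (n + 1) * fps_nth f (n + 1)) (finite_subsets_at_top I)"
    by (intro tendsto_mps_mult f tendsto_const)
  then have "((\<lambda>F. fps_nth (prod G F * sum Q F) n) \<longlongrightarrow> fps_nth (fps_deriv f) n)
      (finite_subsets_at_top I)"
    by (simp add: prod_log_deriv[OF GQ])
  ultimately show "fps_nth (f * p) n = fps_nth (fps_deriv f) n"
    by (rule tendsto_unique[OF finite_subsets_at_top_neq_bot])
qed

text \<open>
  The power sum of the indeterminates themselves, an element of the coefficient ring rather than a
  series in \<open>t\<close>.
\<close>

definition var_power_sum :: "nat \<Rightarrow> 'i set \<Rightarrow> ('i, 'a::comm_ring_1) mps" where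
  "var_power_sum n I = (\<Sum>\<^sub>\<infinity>r\<in>I. mps_var r ^ n)"

lemma var_power_has_sum:
  "((\<lambda>r. mps_var r ^ Suc j) has_sum (var_power_sum (Suc j) I :: ('i, 'a::comm_ring_1) mps)) I"
proof -
  have "(\<lambda>r. mps_var r ^ Suc j :: ('i, 'a) mps) summable_on I"
    using frac_alphabet_power_summable[of 1 j I, where 'a = 'a] by (simp add: frac_alphabet_eq)
  then show ?thesis unfolding var_power_sum_def by (rule has_sum_infsum)
qed

lemma has_sum_mps_cmult:
  fixes g :: "'x \<Rightarrow> ('i, 'a::comm_ring_1) mps"
  assumes "(g has_sum s) A"
  shows "((\<lambda>x. c * g x) has_sum c * s) A"
proof -
  have "sum (\<lambda>x. c * g x) = (\<lambda>F. c * sum g F)"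
    by (simp add: fun_eq_iff sum_distrib_left)
  then show ?thesis
    using assms unfolding has_sum_def by (simp only:) (intro tendsto_mps_mult tendsto_const)
qed

text \<open>
  For a single indeterminate this is \<open>(1 + x s) (\<Sum>j. (-1)^j x^(j+1) s^j) = x\<close>.
\<close>

lemma newton_elem_sym:
  fixes I :: "'i set"
  defines "e \<equiv> Abs_fps (\<lambda>n. elem_sym n I mps_var) :: ('i, 'a::comm_ring_1) mps fps"
  shows "e * Abs_fps (\<lambda>j. (- 1) ^ j * var_power_sum (Suc j) I) = fps_deriv e"
proof (rule limit_log_deriv)
  fix r :: 'i
  let ?x = "mps_var r :: ('i, 'a) mps"
  show "(1 + fps_const ?x * fps_X) * Abs_fps (\<lambda>j. (- 1) ^ j * ?x ^ Suc j)
      = fps_deriv (1 + fps_const ?x * fps_X)"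
  proof (rule fps_ext)
    fix n
    show "fps_nth ((1 + fps_const ?x * fps_X) * Abs_fps (\<lambda>j. (- 1) ^ j * ?x ^ Suc j)) n
        = fps_nth (fps_deriv (1 + fps_const ?x * fps_X)) n"
      by (cases n) (simp_all add: distrib_right mult.assoc mult.left_commute)
  qed
next
  fix n
  show "((\<lambda>F. fps_nth (\<Prod>r\<in>F. 1 + fps_const (mps_var r) * fps_X) n) \<longlongrightarrow> fps_nth e n)
      (finite_subsets_at_top I)"
    unfolding e_def fps_nth_Abs_fps by (rule elem_sym_tendsto)
next
  fix n
  show "((\<lambda>r. fps_nth (Abs_fps (\<lambda>j. (- 1) ^ j * mps_var r ^ Suc j)) n)
      has_sum fps_nth (Abs_fps (\<lambda>j. (- 1) ^ j * var_power_sum (Suc j) I)) n) I"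
    unfolding fps_nth_Abs_fps by (intro has_sum_mps_cmult var_power_has_sum)
qed

text \<open>
  For a single indeterminate, the coefficient of \<open>s^n\<close> on the left collects \<open>n + 1\<close> equal terms
  \<open>x^i x^(n-i+1)\<close>, as does the derivative of the geometric series.
\<close>

lemma newton_complete_sym:
  fixes I :: "'i set"
  defines "h \<equiv> Abs_fps (\<lambda>n. complete_sym n I mps_var) :: ('i, 'a::comm_ring_1) mps fps"
  shows "h * Abs_fps (\<lambda>j. var_power_sum (Suc j) I) = fps_deriv h"
proof (rule limit_log_deriv)
  fix r :: 'i
  let ?x = "mps_var r :: ('i, 'a) mps"
  show "fps_right_inverse (1 - fps_const ?x * fps_X) 1 * Abs_fps (\<lambda>j. ?x ^ Suc j)
      = fps_deriv (fps_right_inverse (1 - fps_const ?x * fps_X) 1)"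
  proof (rule fps_ext)
    fix n
    have "(\<Sum>i=0..n. ?x ^ i * ?x ^ Suc (n - i)) = (\<Sum>i=0..n. ?x ^ Suc n)"
      by (rule sum.cong) (simp_all flip: power_add power_Suc)
    then show "fps_nth (fps_right_inverse (1 - fps_const ?x * fps_X) 1 * Abs_fps (\<lambda>j. ?x ^ Suc j)) n
        = fps_nth (fps_deriv (fps_right_inverse (1 - fps_const ?x * fps_X) 1)) n"
      by (simp add: fps_right_inverse_geometric fps_mult_nth)
  qed
next
  fix n
  show "((\<lambda>F. fps_nth (\<Prod>r\<in>F. fps_right_inverse (1 - fps_const (mps_var r) * fps_X) 1) n)
      \<longlongrightarrow> fps_nth h n) (finite_subsets_at_top I)"
    unfolding h_def fps_nth_Abs_fps by (rule complete_sym_tendsto)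
next
  fix n
  show "((\<lambda>r. fps_nth (Abs_fps (\<lambda>j. mps_var r ^ Suc j)) n)
      has_sum fps_nth (Abs_fps (\<lambda>j. var_power_sum (Suc j) I)) n) I"
    unfolding fps_nth_Abs_fps by (rule var_power_has_sum)
qed

lemma fps_prod_nth_0:
  fixes g :: "'x \<Rightarrow> 'r::comm_ring_1 fps"
  shows "fps_nth (prod g F) 0 = (\<Prod>r\<in>F. fps_nth (g r) 0)"
  by (induction F rule: infinite_finite_induct) simp_all

lemma elem_sym_0: "elem_sym 0 I mps_var = (1 :: ('i, 'a::comm_ring_1) mps)"
proof (rule tendsto_unique[OF finite_subsets_at_top_neq_bot elem_sym_tendsto])
  show "((\<lambda>F. fps_nth (\<Prod>r\<in>F. 1 + fps_const (mps_var r) * fps_X) 0)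
      \<longlongrightarrow> (1 :: ('i, 'a) mps)) (finite_subsets_at_top I)"
    by (simp add: fps_prod_nth_0)
qed

lemma complete_sym_0: "complete_sym 0 I mps_var = (1 :: ('i, 'a::comm_ring_1) mps)"
proof (rule tendsto_unique[OF finite_subsets_at_top_neq_bot complete_sym_tendsto])
  show "((\<lambda>F. fps_nth (\<Prod>r\<in>F. fps_right_inverse (1 - fps_const (mps_var r) * fps_X) 1) 0)
      \<longlongrightarrow> (1 :: ('i, 'a) mps)) (finite_subsets_at_top I)"
    by (simp add: fps_prod_nth_0)
qed

text \<open>
  Newton's identity gives \<open>(-1)^(n-1) p_n\<close> with the signs \<open>(-1)^(l-1)\<close>; the two signs combine to
  \<open>(-1)^(n-l)\<close> as \<open>1 \<le> l \<le> n\<close> for a partition of \<open>n > 0\<close>.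
\<close>

lemma waring_elem_sym:
  assumes n: "n > 0"
  shows "(var_power_sum n I :: ('i, 'a::field_char_0) mps)
    = (\<Sum>\<mu> | is_partition \<mu> \<and> sum_mset \<mu> = n.
        mps_const ((- 1) ^ (sum_mset \<mu> - size \<mu>) *
          (of_nat n * fact (size \<mu> - 1) / (\<Prod>i\<in>set_mset \<mu>. fact (count \<mu> i))))
        * elem_sym_part \<mu> I mps_var)"
proof -
  let ?w = "\<lambda>\<mu>. of_nat n * fact (size \<mu> - 1) / (\<Prod>i\<in>set_mset \<mu>. fact (count \<mu> i)) :: 'a"
  have eq: "(- 1) ^ (n - 1) * var_power_sum n I = (\<Sum>\<mu> | is_partition \<mu> \<and> sum_mset \<mu> = n.
      mps_const ((- 1) ^ (size \<mu> - 1) * ?w \<mu>) * elem_sym_part \<mu> I mps_var)"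
    using waring_log_deriv[OF _ newton_elem_sym n, of I, where 'a = 'a] n
    by (simp add: elem_sym_0 elem_sym_part_def)
  have "var_power_sum n I = (- 1) ^ (n - 1) * ((- 1) ^ (n - 1) * var_power_sum n I :: ('i, 'a) mps)"
    by (simp flip: mult.assoc power_mult_distrib)
  also have "\<dots> = (\<Sum>\<mu> | is_partition \<mu> \<and> sum_mset \<mu> = n.
      mps_const ((- 1) ^ (n - 1) * ((- 1) ^ (size \<mu> - 1) * ?w \<mu>)) * elem_sym_part \<mu> I mps_var)"
    unfolding eq sum_distrib_left mult.assoc[symmetric]
    by (simp only: mps_const_mult mps_const_minus_one_power mult.assoc)
  also have "\<dots> = (\<Sum>\<mu> | is_partition \<mu> \<and> sum_mset \<mu> = n.
      mps_const ((- 1) ^ (sum_mset \<mu> - size \<mu>) * ?w \<mu>) * elem_sym_part \<mu> I mps_var)"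
  proof (rule sum.cong[OF refl])
    fix \<mu> assume "\<mu> \<in> {\<mu>. is_partition \<mu> \<and> sum_mset \<mu> = n}"
    then have \<mu>: "is_partition \<mu>" "sum_mset \<mu> = n" by auto
    then have "size \<mu> \<noteq> 0" "size \<mu> \<le> n"
      using n size_le_sum_mset_partition by auto
    then have "n - 1 + (size \<mu> - 1) = (n - size \<mu>) + 2 * (size \<mu> - 1)" by arith
    then have "(- 1) ^ (n - 1) * (- 1) ^ (size \<mu> - 1) = ((- 1) ^ (n - size \<mu>) :: 'a)"
      by (simp only: power_add[symmetric]) (simp add: power_add)
    then show "mps_const ((- 1) ^ (n - 1) * ((- 1) ^ (size \<mu> - 1) * ?w \<mu>)) * elem_sym_part \<mu> I mps_var
        = mps_const ((- 1) ^ (sum_mset \<mu> - size \<mu>) * ?w \<mu>) * elem_sym_part \<mu> I mps_var"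
      by (simp only: mult.assoc[symmetric] \<mu>)
  qed
  finally show ?thesis .
qed

lemma waring_complete_sym:
  assumes n: "n > 0"
  shows "(var_power_sum n I :: ('i, 'a::field_char_0) mps)
    = (\<Sum>\<mu> | is_partition \<mu> \<and> sum_mset \<mu> = n.
        mps_const ((- 1) ^ (size \<mu> - 1) *
          (of_nat n * fact (size \<mu> - 1) / (\<Prod>i\<in>set_mset \<mu>. fact (count \<mu> i))))
        * complete_sym_part \<mu> I mps_var)"
  using waring_log_deriv[OF _ newton_complete_sym n, of I, where 'a = 'a] n
  by (simp add: complete_sym_0 complete_sym_part_def)


section \<open>Power sums of the fractions\<close>

text \<open>
  The negative binomial series, by induction with the hockey-stick identity; this form is valid over
  rings in which the integers need not be invertible.
\<close>

lemma geometric_power_nth: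
  fixes x :: "'r::comm_ring_1"
  shows "fps_nth (Abs_fps (\<lambda>j. x ^ j) ^ Suc r) n = of_nat ((r + n) choose n) * x ^ n"
proof (induction r arbitrary: n)
  case (Suc r)
  have "fps_nth (Abs_fps (\<lambda>j. x ^ j) ^ Suc (Suc r)) n
      = fps_nth (Abs_fps (\<lambda>j. x ^ j) ^ Suc r * Abs_fps (\<lambda>j. x ^ j)) n"
    by (simp add: mult_ac)
  also have "\<dots> = (\<Sum>i=0..n. of_nat ((r + i) choose i) * x ^ i * x ^ (n - i))"
    unfolding fps_mult_nth Suc.IH by simp
  also have "\<dots> = (\<Sum>i\<le>n. of_nat ((r + i) choose i) * x ^ n)"
    by (rule sum.cong) (auto simp: mult.assoc simp flip: power_add)
  also have "\<dots> = of_nat (\<Sum>i\<le>n. (r + i) choose i) * x ^ n"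
    by (simp add: sum_distrib_right)
  finally show ?case by (simp only: sum_choose_lower add_Suc)
qed simp

lemma power_sum_frac_alphabet_nth:
  "fps_nth (power_sum (Suc r) I frac_alphabet) j
    = (of_nat ((r + j) choose j) * var_power_sum (Suc r + j) I :: ('i, 'a::comm_ring_1) mps)"
proof -
  have "fps_nth (frac_alphabet i ^ Suc r) j
      = of_nat ((r + j) choose j) * (mps_var i :: ('i, 'a) mps) ^ Suc (r + j)" for i
  proof -
    let ?x = "mps_var i :: ('i, 'a) mps"
    have "frac_alphabet i = fps_const ?x * Abs_fps (\<lambda>j. ?x ^ j)"
      by (simp add: frac_alphabet_eq fps_eq_iff)
    then have "frac_alphabet i ^ Suc r = fps_const (?x ^ Suc r) * Abs_fps (\<lambda>j. ?x ^ j) ^ Suc r"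
      by (simp only: power_mult_distrib fps_const_power)
    then show ?thesis
      by (simp only: fps_mult_left_const_nth geometric_power_nth) (simp add: power_add mult_ac)
  qed
  then have "((\<lambda>i. fps_nth (frac_alphabet i ^ Suc r) j)
      has_sum (of_nat ((r + j) choose j) * var_power_sum (Suc (r + j)) I :: ('i, 'a) mps)) I"
    by (simp only:) (intro has_sum_mps_cmult var_power_has_sum)
  then show ?thesis
    by (simp add: power_sum_def infsumI)
qed

text \<open>
  A family of monomials in \<open>t\<close> converges \<open>t\<close>-adically as soon as each degree occurs finitely often.
\<close>

lemma has_sum_graded:
  fixes c :: "'x \<Rightarrow> 'r::comm_ring_1" and d :: "'x \<Rightarrow> nat"
  assumes fin: "\<And>j. finite {x \<in> A. d x = j}"
    and sum: "\<And>j. (\<Sum>x\<in>{x \<in> A. d x = j}. c x) = fps_nth s j"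
  shows "((\<lambda>x. fps_X ^ d x * fps_const (c x)) has_sum s) A"
proof (rule has_sum_fpsI)
  fix j
  let ?T = "{x \<in> A. fps_nth (fps_X ^ d x * fps_const (c x)) j \<noteq> 0}"
  have nth: "fps_nth (fps_X ^ d x * fps_const (c x)) j = (if d x = j then c x else 0)" for x
    by (auto simp: fps_X_power_mult_nth)
  have sub: "?T \<subseteq> {x \<in> A. d x = j}"
    by (auto simp: nth split: if_splits)
  then show "finite ?T" using fin finite_subset by blast
  have "(\<Sum>x\<in>?T. fps_nth (fps_X ^ d x * fps_const (c x)) j)
      = (\<Sum>x\<in>{x \<in> A. d x = j}. fps_nth (fps_X ^ d x * fps_const (c x)) j)"
    by (rule sum.mono_neutral_left) (use fin sub in auto)
  then show "fps_nth s j = (\<Sum>x | x \<in> A \<and> fps_nth (fps_X ^ d x * fps_const (c x)) j \<noteq> 0.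
      fps_nth (fps_X ^ d x * fps_const (c x)) j)"
    by (simp add: nth flip: sum)
qed

text \<open>
  Any Waring-type formula for the power sums of the indeterminates yields a formula for the
  fractions. Here \<open>S\<close> stands for the \<open>e_\<mu>\<close> or the \<open>h_\<mu>\<close>, \<open>\<epsilon>\<close> for the sign and \<open>w\<close> for
  \<open>\<Prod>i. m_i!\<close>.
\<close>

lemma power_sum_frac_alphabet_of_waring:
  fixes \<epsilon> w :: "nat multiset \<Rightarrow> 'a::field_char_0" and S :: "nat multiset \<Rightarrow> ('i, 'a) mps"
  assumes k: "k \<ge> 1"
    and waring: "\<And>n. n > 0 \<Longrightarrow> var_power_sum n I = (\<Sum>\<mu> | is_partition \<mu> \<and> sum_mset \<mu> = n.
      mps_const (\<epsilon> \<mu> * (of_nat n * fact (size \<mu> - 1) / w \<mu>)) * S \<mu>)"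
  shows "((\<lambda>\<mu>. fps_X ^ (sum_mset \<mu> - k) *
      fps_const (mps_const (of_nat (sum_mset \<mu> choose k) * \<epsilon> \<mu> *
        (of_nat k * fact (size \<mu> - 1) / w \<mu>)) * S \<mu>))
    has_sum (power_sum k I frac_alphabet)) {\<mu>. is_partition \<mu> \<and> sum_mset \<mu> \<ge> k}"
proof (rule has_sum_graded)
  fix j
  have eq: "{\<mu> \<in> {\<mu>. is_partition \<mu> \<and> sum_mset \<mu> \<ge> k}. sum_mset \<mu> - k = j}
      = {\<mu>. is_partition \<mu> \<and> sum_mset \<mu> = k + j}"
    by auto
  show "finite {\<mu> \<in> {\<mu>. is_partition \<mu> \<and> sum_mset \<mu> \<ge> k}. sum_mset \<mu> - k = j}"
    unfolding eq by (rule finite_partitions_of)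
  obtain r where r: "k = Suc r" using k by (cases k) auto
  \<comment> \<open>\<open>k + j\<close> comes from Waring's formula for \<open>p_(k+j)\<close>, and is traded for the factor \<open>k\<close>.\<close>
  have "(k + j) * ((r + j) choose j) = k * ((k + j) choose k)"
    using Suc_times_binomial[of r "r + j"] binomial_symmetric[of j "r + j"] by (simp add: r)
  then have choose: "of_nat ((r + j) choose j) * of_nat (k + j)
      = (of_nat ((k + j) choose k) * of_nat k :: 'a)"
    by (simp only: mult.commute flip: of_nat_mult)
  have "fps_nth (power_sum k I frac_alphabet) j
      = mps_const (of_nat ((r + j) choose j)) * (\<Sum>\<mu> | is_partition \<mu> \<and> sum_mset \<mu> = k + j.
        mps_const (\<epsilon> \<mu> * (of_nat (k + j) * fact (size \<mu> - 1) / w \<mu>)) * S \<mu>)"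
    using waring[of "k + j"] by (simp add: r power_sum_frac_alphabet_nth mps_const_of_nat)
  also have "\<dots> = (\<Sum>\<mu> | is_partition \<mu> \<and> sum_mset \<mu> = k + j.
      mps_const (of_nat (sum_mset \<mu> choose k) * \<epsilon> \<mu> *
        (of_nat k * fact (size \<mu> - 1) / w \<mu>)) * S \<mu>)"
    unfolding sum_distrib_left
  proof (rule sum.cong[OF refl])
    fix \<mu> assume \<mu>: "\<mu> \<in> {\<mu>. is_partition \<mu> \<and> sum_mset \<mu> = k + j}"
    have "of_nat ((r + j) choose j) * (\<epsilon> \<mu> * (of_nat (k + j) * fact (size \<mu> - 1) / w \<mu>))
        = (of_nat ((r + j) choose j) * of_nat (k + j)) * (\<epsilon> \<mu> * (fact (size \<mu> - 1) / w \<mu>))"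
      by (simp add: mult_ac del: of_nat_add)
    also have "\<dots> = of_nat (sum_mset \<mu> choose k) * \<epsilon> \<mu> * (of_nat k * fact (size \<mu> - 1) / w \<mu>)"
      unfolding choose using \<mu> by (simp add: mult_ac)
    finally show "mps_const (of_nat ((r + j) choose j)) *
        (mps_const (\<epsilon> \<mu> * (of_nat (k + j) * fact (size \<mu> - 1) / w \<mu>)) * S \<mu>)
      = mps_const (of_nat (sum_mset \<mu> choose k) * \<epsilon> \<mu> *
        (of_nat k * fact (size \<mu> - 1) / w \<mu>)) * S \<mu>"
      by (simp only: mult.assoc[symmetric] flip: mps_const_mult)
  qed
  finally show "(\<Sum>\<mu>\<in>{\<mu> \<in> {\<mu>. is_partition \<mu> \<and> sum_mset \<mu> \<ge> k}. sum_mset \<mu> - k = j}.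
      mps_const (of_nat (sum_mset \<mu> choose k) * \<epsilon> \<mu> *
        (of_nat k * fact (size \<mu> - 1) / w \<mu>)) * S \<mu>)
      = fps_nth (power_sum k I frac_alphabet) j"
    unfolding eq by simp
qed

theorem mainTheorem1:
  fixes I :: "'i set" and k :: nat
  assumes "k \<ge> 1"
  shows
    "((\<lambda>\<mu>. fps_X ^ (sum_mset \<mu> - k) *
         fps_const (mps_const (of_nat (sum_mset \<mu> choose k) * (- 1) ^ (sum_mset \<mu> - size \<mu>) *
             (of_nat k * fact (size \<mu> - 1) / (\<Prod>i\<in>set_mset \<mu>. fact (count \<mu> i)))) *
           elem_sym_part \<mu> I mps_var))
       has_sum (power_sum k I frac_alphabet :: ('i, 'a::field_char_0) mps fps))
       {\<mu>. is_partition \<mu> \<and> sum_mset \<mu> \<ge> k} \<and>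
     ((\<lambda>\<mu>. fps_X ^ (sum_mset \<mu> - k) *
         fps_const (mps_const (of_nat (sum_mset \<mu> choose k) * (- 1) ^ (size \<mu> - 1) *
             (of_nat k * fact (size \<mu> - 1) / (\<Prod>i\<in>set_mset \<mu>. fact (count \<mu> i)))) *
           complete_sym_part \<mu> I mps_var))
       has_sum (power_sum k I frac_alphabet :: ('i, 'a::field_char_0) mps fps))
       {\<mu>. is_partition \<mu> \<and> sum_mset \<mu> \<ge> k}"
  by (intro conjI power_sum_frac_alphabet_of_waring assms waring_elem_sym waring_complete_sym)

end
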